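(* Let $\sigma(m)=\sum_{d\mid m}d$. Define the D'Arcais polynomials $P_0(x)=1$, $P_n(x)=\frac{x}{n}\sum_{k=1}^{n}\sigma(k)P_{n-k}(x)$ for $n\geq1$ (equivalently $\sum_{n\geq0}P_n(x)t^n=\prod_{m\geq1}(1-t^m)^{-x}$), and let $\Delta_n(x)=(P_n(x))^{n+1}-(P_{n+1}(x))^{n}$ with largest real zero $x_n$. Then $x_n<1$ for all $6\leq n\leq 150$.
   Context: For $n\geq1$, $\Delta_n$ is a nonzero polynomial with the real zero $x=0$; $x_n$ is its largest real zero. *)

theory Defs
  imports Complex_Main "HOL-Computational_Algebra.Polynomial"
begin

definition sigma :: "nat \<Rightarrow> nat" where
  "sigma m = (\<Sum>d | d dvd m. d)"

fun darcais :: "nat \<Rightarrow> real poly" where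
  "darcais 0 = 1"
| "darcais (Suc n) =
     smult (1 / real (Suc n))
       ([:0, 1:] * (\<Sum>k = 1..Suc n. smult (real (sigma k)) (darcais (Suc n - k))))"

definition Delta :: "nat \<Rightarrow> real poly" where
  "Delta n = darcais n ^ (n + 1) - darcais (n + 1) ^ n"

text \<open>
  For \<open>n \<ge> 1\<close> the polynomial \<open>Delta n\<close> is nonzero and vanishes at \<open>0\<close>, so the
  set below is finite and nonempty. For \<open>n = 0\<close> the polynomial is zero, so the set is
  infinite and \<open>Max\<close> carries no information.
\<close>

definition largest_zero :: "nat \<Rightarrow> real" where
  "largest_zero n = Max {x. poly (Delta n) x = 0}"

end

theory Submission
  imports Defs "HOL-Computational_Algebra.Formal_Power_Series"
begin

text \<open>
  Write \<open>s\<^sub>n(x) = (n + 1) P\<^sub>n\<^sub>+\<^sub>1(x) / P\<^sub>n(x)\<close>. The generating function \<open>F\<^sub>x\<close> satisfies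
  \<open>F\<^sub>a\<^sub>+\<^sub>y = F\<^sub>y F\<^sub>a\<close> and \<open>F\<^sub>x' = x G F\<^sub>x\<close> with \<open>G\<close> independent of \<open>x\<close>. Hence, for \<open>x \<ge> a\<close>,
  the quotient \<open>s\<^sub>n(x) / x\<close> is a weighted mean of the numbers \<open>s\<^sub>i(a) / a\<close>, \<open>i \<le> n\<close>, in which the mean
  index \<open>i\<close> is exactly \<open>n a / x\<close>. A bound \<open>s\<^sub>i(a) \<le> \<alpha> + \<beta> i\<close> for all \<open>i \<le> n\<close> at the single
  point \<open>a\<close> therefore gives \<open>s\<^sub>n(x) \<le> \<alpha> x / a + \<beta> n\<close> for all \<open>x \<ge> a\<close>, and likewise for lower bounds.
  Since \<open>P\<^sub>n\<close> is increasing, this yields \<open>P\<^sub>n\<^sub>+\<^sub>1 / P\<^sub>n \<le> \<rho> < P\<^sub>n\<^bsup>1/n\<^esup>\<close> on an interval to the right of \<open>a\<close>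
  from the exact values of \<open>P\<^sub>i(a)\<close>. Finitely many base points cover \<open>[1, 9]\<close>, and one pair of lines at
  \<open>a = 9\<close> covers \<open>[9, \<infinity>)\<close>, by induction on \<open>n\<close> with Bernoulli's inequality.
\<close>

section \<open>Propagation of linear bounds on the ratios\<close>

definition P :: "nat \<Rightarrow> real \<Rightarrow> real" where
  "P n x = poly (darcais n) x"

lemma P_0 [simp]: "P 0 x = 1"
  by (simp add: P_def)

lemma P_Suc: "real (Suc n) * P (Suc n) x = x * (\<Sum>k\<le>n. real (sigma (Suc k)) * P (n - k) x)"
proof -
  have "(\<Sum>k = 1..Suc n. real (sigma k) * P (Suc n - k) x) = (\<Sum>k\<le>n. real (sigma (Suc k)) * P (n - k) x)"
    by (rule sum.reindex_bij_witness[of _ Suc "\<lambda>k. k - 1"]) auto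
  thus ?thesis
    by (simp add: P_def poly_sum del: sum.cl_ivl_Suc of_nat_Suc)
qed

lemma P_nonneg: "0 \<le> x \<Longrightarrow> 0 \<le> P n x"
proof (induction n rule: less_induct)
  case (less n)
  show ?case
  proof (cases n)
    case (Suc m)
    have "0 \<le> real (Suc m) * P (Suc m) x"
      unfolding P_Suc using less Suc by (intro mult_nonneg_nonneg sum_nonneg) auto
    thus ?thesis
      using Suc by (simp add: zero_le_mult_iff del: of_nat_Suc)
  qed simp
qed

lemma P_at_0: "0 < n \<Longrightarrow> P n 0 = 0"
  using P_Suc[of "n - 1" 0] by simp

section \<open>Generating functions and the addition formula\<close>

definition F :: "real \<Rightarrow> real fps" where
  "F x = Abs_fps (\<lambda>n. P n x)"

definition G :: "real fps" where
  "G = Abs_fps (\<lambda>n. real (sigma (Suc n)))"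

lemma F_nth [simp]: "fps_nth (F x) n = P n x"
  by (simp add: F_def)

lemma GF_nth: "fps_nth (G * F x) n = (\<Sum>k\<le>n. real (sigma (Suc k)) * P (n - k) x)"
  by (simp add: fps_mult_nth G_def atLeast0AtMost)

lemma deriv_F: "fps_deriv (F x) = fps_const x * (G * F x)"
proof (rule fps_ext)
  fix n
  show "fps_nth (fps_deriv (F x)) n = fps_nth (fps_const x * (G * F x)) n"
    using P_Suc[of n x] by (simp add: GF_nth)
qed

text \<open>Comparing coefficients of index m, the equation determines coefficient m + 1 from the
  earlier ones.\<close>

lemma fps_linear_ode_unique:
  fixes A B K :: "real fps"
  assumes "fps_deriv A = K * A" "fps_deriv B = K * B" "fps_nth A 0 = fps_nth B 0"
  shows "A = B"
proof (rule fps_ext)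
  fix n
  show "fps_nth A n = fps_nth B n"
  proof (induction n rule: less_induct)
    case (less n)
    show ?case
    proof (cases n)
      case (Suc m)
      have "fps_nth (K * A) m = fps_nth (K * B) m"
        using less Suc by (auto simp: fps_mult_nth intro!: sum.cong)
      hence "fps_nth (fps_deriv A) m = fps_nth (fps_deriv B) m"
        using assms by simp
      thus ?thesis
        using Suc by simp
    qed (use assms in simp)
  qed
qed

text \<open>Both sides have constant term 1 and solve the same linear equation, with coefficient (a
  + y) G.\<close>

lemma F_add: "F (a + y) = F y * F a"
proof (rule fps_linear_ode_unique)
  show "fps_deriv (F (a + y)) = (fps_const (a + y) * G) * F (a + y)"
    by (simp add: deriv_F mult.assoc)
  show "fps_deriv (F y * F a) = (fps_const (a + y) * G) * (F y * F a)"
    by (simp add: deriv_F algebra_simps flip: fps_const_add)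
qed simp

lemma P_add: "P n (a + y) = (\<Sum>k\<le>n. P k y * P (n - k) a)"
  using arg_cong[OF F_add, of "\<lambda>f. fps_nth f n" a y] by (simp add: fps_mult_nth atLeast0AtMost)

text \<open>Coefficient comparison in a (F (a + y))' = (a + y) F y (F a)', which follows from
  \<open>F_add\<close> and \<open>deriv_F\<close>.\<close>

lemma P_Suc_add:
  "a * (real (Suc n) * P (Suc n) (a + y))
     = (a + y) * (\<Sum>k\<le>n. P k y * (real (Suc (n - k)) * P (Suc (n - k)) a))"
proof -
  have "fps_const a * (G * F (a + y)) = F y * (fps_const a * (G * F a))"
    by (simp add: F_add mult_ac)
  hence "a * fps_nth (G * F (a + y)) n = fps_nth (F y * (fps_const a * (G * F a))) n"
    by (metis fps_mult_left_const_nth)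
  also have "\<dots> = (\<Sum>k\<le>n. P k y * (real (Suc (n - k)) * P (Suc (n - k)) a))"
    unfolding deriv_F[symmetric] by (simp add: fps_mult_nth atLeast0AtMost)
  finally have "a * fps_nth (G * F (a + y)) n = \<dots>" .
  moreover have "a * (real (Suc n) * P (Suc n) (a + y)) = (a + y) * (a * fps_nth (G * F (a + y)) n)"
    unfolding P_Suc GF_nth by (rule mult.left_commute)
  ultimately show ?thesis
    by simp
qed

text \<open>
  In \<open>P n (a + y) = (\<Sum>k\<le>n. P k y * P (n - k) a)\<close> the weighted mean of the index \<open>n - k\<close> is exactly
  \<open>n * a / (a + y)\<close>.
\<close>

lemma P_first_moment:
  "(a + y) * (\<Sum>k\<le>n. P k y * (real (n - k) * P (n - k) a)) = a * real n * P n (a + y)"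
proof (cases n)
  case (Suc m)
  have "(\<Sum>k\<le>n. P k y * (real (n - k) * P (n - k) a))
      = (\<Sum>k\<le>m. P k y * (real (Suc (m - k)) * P (Suc (m - k)) a))"
    unfolding Suc by (simp add: Suc_diff_le del: of_nat_Suc of_nat_diff cong: sum.cong_simp)
  thus ?thesis
    using P_Suc_add[of a m y] Suc by simp
qed simp

lemma P_mono:
  assumes "0 \<le> a" "a \<le> x"
  shows "P n a \<le> P n x"
proof -
  have "P n a = (\<Sum>k\<in>{0}. P k (x - a) * P (n - k) a)"
    by simp
  also have "\<dots> \<le> (\<Sum>k\<le>n. P k (x - a) * P (n - k) a)"
    using assms by (intro sum_mono2) (auto intro!: mult_nonneg_nonneg P_nonneg)
  also have "\<dots> = P n x"
    using P_add[of n a "x - a"] by simp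
  finally show ?thesis .
qed

lemma P_line:
  "(a + y) * (\<Sum>k\<le>n. P k y * ((\<alpha> + \<beta> * real (n - k)) * P (n - k) a))
     = ((a + y) * \<alpha> + a * \<beta> * real n) * P n (a + y)"
proof -
  have "(a + y) * (\<Sum>k\<le>n. P k y * ((\<alpha> + \<beta> * real (n - k)) * P (n - k) a))
      = (a + y) * \<alpha> * (\<Sum>k\<le>n. P k y * P (n - k) a)
        + \<beta> * ((a + y) * (\<Sum>k\<le>n. P k y * (real (n - k) * P (n - k) a)))"
    by (simp add: algebra_simps sum.distrib sum_distrib_left del: of_nat_diff)
  thus ?thesis
    unfolding P_first_moment P_add[symmetric] by (simp add: algebra_simps)
qed

text \<open>The weights \<open>P k y\<close> are nonnegative, so the line at a may be inserted term
  by term; the mean index n a / x then cancels the factor x / a in the slope.\<close>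

lemma ratio_upper:
  assumes a: "0 < a" "a \<le> x"
    and line: "\<And>i. i \<le> n \<Longrightarrow> real (Suc i) * P (Suc i) a \<le> (\<alpha> + \<beta> * real i) * P i a"
  shows "real (Suc n) * P (Suc n) x \<le> (\<alpha> * (x / a) + \<beta> * real n) * P n x"
proof -
  define y where "y = x - a"
  have x: "x = a + y" and y: "0 \<le> y"
    using a by (auto simp: y_def)
  have "a * (real (Suc n) * P (Suc n) x)
      \<le> (a + y) * (\<Sum>k\<le>n. P k y * ((\<alpha> + \<beta> * real (n - k)) * P (n - k) a))"
    unfolding x P_Suc_add using a y
    by (intro mult_left_mono sum_mono line P_nonneg) (auto simp del: of_nat_Suc of_nat_diff)
  also have "\<dots> = a * ((\<alpha> * (x / a) + \<beta> * real n) * P n x)"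
    unfolding P_line x using a by (simp add: field_simps)
  finally show ?thesis
    using a by simp
qed

lemma ratio_lower:
  assumes a: "0 < a" "a \<le> x"
    and line: "\<And>i. i \<le> n \<Longrightarrow> (\<alpha> + \<beta> * real i) * P i a \<le> real (Suc i) * P (Suc i) a"
  shows "(\<alpha> * (x / a) + \<beta> * real n) * P n x \<le> real (Suc n) * P (Suc n) x"
proof -
  define y where "y = x - a"
  have x: "x = a + y" and y: "0 \<le> y"
    using a by (auto simp: y_def)
  have "a * ((\<alpha> * (x / a) + \<beta> * real n) * P n x)
      = (a + y) * (\<Sum>k\<le>n. P k y * ((\<alpha> + \<beta> * real (n - k)) * P (n - k) a))"
    unfolding P_line x using a by (simp add: field_simps)
  also have "\<dots> \<le> a * (real (Suc n) * P (Suc n) x)"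
    unfolding x P_Suc_add using a y
    by (intro mult_left_mono sum_mono line P_nonneg) (auto simp del: of_nat_Suc of_nat_diff)
  finally show ?thesis
    using a by simp
qed

section \<open>From ratio bounds to the power inequality\<close>

text \<open>\<rho> bounds every ratio P (m + 1) / P m with N \<le> m \<le> M on [a, d]: as 0 \<le>
  \<alpha> and \<beta> \<le> \<rho>, the worst case is x = d, m = N.\<close>

lemma P_power_less_block:
  assumes a: "0 < a" "a \<le> x" "x \<le> d" and n: "N \<le> n" "n \<le> M"
    and line: "\<And>i. i \<le> M \<Longrightarrow> real (Suc i) * P (Suc i) a \<le> (\<alpha> + \<beta> * real i) * P i a"
    and "0 \<le> \<alpha>" "\<beta> \<le> \<rho>" "0 < \<rho>" "\<alpha> * (d / a) + \<beta> * real N \<le> \<rho> * real (Suc N)"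
    and pow: "\<rho> ^ M < P M a"
  shows "P (Suc n) x ^ n < P n x ^ Suc n"
proof -
  have le: "P (Suc m) x \<le> \<rho> * P m x" if "N \<le> m" "m \<le> M" for m
  proof -
    have "real (Suc m) * P (Suc m) x \<le> (\<alpha> * (x / a) + \<beta> * real m) * P m x"
      using that by (intro ratio_upper a line) auto
    also have "\<dots> \<le> (\<rho> * real (Suc m)) * P m x"
    proof (intro mult_right_mono P_nonneg)
      have "\<alpha> * (x / a) \<le> \<alpha> * (d / a)"
        using a assms by (intro mult_left_mono divide_right_mono) auto
      moreover have "\<beta> * (real m - real N) \<le> \<rho> * (real m - real N)"
        using assms that by (intro mult_right_mono) auto
      ultimately show "\<alpha> * (x / a) + \<beta> * real m \<le> \<rho> * real (Suc m)"
        using assms by (simp add: algebra_simps)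
    qed (use a in auto)
    finally have "real (Suc m) * P (Suc m) x \<le> real (Suc m) * (\<rho> * P m x)"
      by (simp only: mult_ac)
    thus ?thesis
      by (simp del: of_nat_Suc)
  qed
  \<comment> \<open>Descent from M: divide \<rho>^(m+1) < P (m + 1) x \<le> \<rho> P m x by
    \<rho>.\<close>
  have gt: "N \<le> M - i \<Longrightarrow> \<rho> ^ (M - i) < P (M - i) x" for i
  proof (induction i)
    case 0
    show ?case
      using pow P_mono[of a x M] a by simp
  next
    case (Suc i)
    show ?case
    proof (cases "i < M")
      case True
      hence eq: "M - i = Suc (M - Suc i)"
        by simp
      have "\<rho> * \<rho> ^ (M - Suc i) < P (Suc (M - Suc i)) x"
        using Suc eq by simp
      also have "\<dots> \<le> \<rho> * P (M - Suc i) x"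
        using Suc by (intro le) auto
      finally show ?thesis
        using \<open>0 < \<rho>\<close> by simp
    qed (use Suc in simp)
  qed
  have "P (Suc n) x ^ n \<le> (\<rho> * P n x) ^ n"
    using a n by (intro power_mono le P_nonneg) auto
  also have "\<dots> = \<rho> ^ n * P n x ^ n"
    by (simp add: power_mult_distrib)
  also have "\<dots> < P n x * P n x ^ n"
    using gt[of "M - n"] n \<open>0 < \<rho>\<close> by (intro mult_strict_right_mono zero_less_power) (auto intro: less_trans[OF zero_less_power])
  finally show ?thesis
    by simp
qed

text \<open>\<open>A m\<close> bounds P (m + 1) / P m from above, so \<open>A m ^ m < P m x\<close>
  suffices. This goes by induction from m = 6, with the lower line controlling the growth of
  P.\<close>

lemma P_power_less_tail:
  assumes a: "0 < a" "a \<le> x" "9 \<le> x" and n: "6 \<le> n" "n \<le> 150"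
    and upper: "\<And>i. i \<le> 150 \<Longrightarrow> real (Suc i) * P (Suc i) a \<le> (39/20 * a + 263/200 * real i) * P i a"
    and lower: "\<And>i. i \<le> 150 \<Longrightarrow> (a + 129/100 * real i) * P i a \<le> real (Suc i) * P (Suc i) a"
  shows "P (Suc n) x ^ n < P n x ^ Suc n"
proof -
  define A where "A = (\<lambda>m. (39/20 * x + 263/200 * real m) / real (Suc m))"
  have A_pos: "0 < A m" for m
    using a by (auto simp: A_def intro!: divide_pos_pos add_pos_nonneg)
  have up: "P (Suc m) x \<le> A m * P m x" if "m \<le> 150" for m
    using ratio_upper[OF a(1,2), of m "39/20 * a" "263/200"] upper that a
    by (simp add: A_def field_simps del: of_nat_Suc)
  have low: "(x + 129/100 * real m) / real (Suc m) * P m x \<le> P (Suc m) x" if "m \<le> 150" for m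
    using ratio_lower[OF a(1,2), of m a "129/100"] lower that a
    by (simp add: field_simps del: of_nat_Suc)
  have gt: "6 \<le> m \<Longrightarrow> m \<le> 150 \<Longrightarrow> A m ^ m < P m x" for m
  proof (induction m rule: nat_induct_at_least)
    case base
    define c where "c = (\<lambda>j. x + 129/100 * real j)"
    have c: "0 \<le> c j" for j
      using a by (simp add: c_def)
    have step: "(\<Prod>j<m. c j) \<le> fact m * P m x" if "m \<le> 6" for m
      using that
    proof (induction m)
      case (Suc m)
      have "(\<Prod>j<Suc m. c j) \<le> c m * (fact m * P m x)"
        using Suc c[of m] by (auto intro!: mult_left_mono simp: mult.commute[of _ "c m"])
      also have "\<dots> = fact (Suc m) * (c m / real (Suc m) * P m x)"
        by (simp add: field_simps)
      also have "\<dots> \<le> fact (Suc m) * P (Suc m) x"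
        using low[of m] Suc by (intro mult_left_mono) (auto simp: c_def)
      finally show ?case .
    qed simp
    \<comment> \<open>Among the pairs c j * c (5 - j) the one with j = 0 is smallest.\<close>
    have "(\<Prod>j<6. c j) = (c 0 * c 5) * (c 1 * c 4) * (c 2 * c 3)"
      by (simp add: eval_nat_numeral lessThan_Suc mult_ac)
    moreover have "c 0 * c 5 \<le> c 1 * c 4" "c 0 * c 5 \<le> c 2 * c 3"
      using a by (auto simp: c_def field_simps)
    ultimately have "(c 0 * c 5) ^ 3 \<le> (\<Prod>j<6. c j)"
      using c by (auto simp: power3_eq_cube intro!: mult_mono)
    also have "\<dots> \<le> 720 * P 6 x"
      using step[of 6] by (simp add: fact_numeral)
    finally have P6: "(c 0 * c 5) ^ 3 / 720 \<le> P 6 x"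
      by simp
    have "9 * 9 \<le> x * x"
      using a by (intro mult_mono) auto
    \<comment> \<open>The factor 54/10 is small enough because 720 * (54/10)^3 < 7^6.\<close>
    moreover have "54/10 * (c 0 * c 5) - (39/20 * x + 263/200 * 6)\<^sup>2
        = 639/400 * (x * x) + 4059/1000 * x - 622521/10000"
      by (simp add: c_def power2_eq_square field_simps)
    ultimately have "(39/20 * x + 263/200 * 6)\<^sup>2 \<le> 54/10 * (c 0 * c 5)"
      using a by linarith
    hence "((39/20 * x + 263/200 * 6)\<^sup>2) ^ 3 \<le> (54/10 * (c 0 * c 5)) ^ 3"
      by (intro power_mono) auto
    moreover have "A 6 ^ 6 = ((39/20 * x + 263/200 * 6)\<^sup>2) ^ 3 / 7 ^ 6"
      by (simp add: A_def power_divide flip: power_mult)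
    moreover have "0 < (c 0 * c 5) ^ 3"
      using a by (simp add: c_def)
    ultimately show ?case
      using P6 by (simp add: power_mult_distrib power_divide field_simps)
  next
    case (Suc m)
    \<comment> \<open>Bernoulli bounds (1 + z)^(m+1) from below, which reduces the step to an
      inequality between quadratics in x and m.\<close>
    define z where "z = A m / A (Suc m) - 1"
    have z: "real (Suc m) * z = (39/20 * x - 263/200) / (39/20 * x + 263/200 * real (Suc m))"
    proof -
      define q w where "q = 39/20 * x + 263/200 * real (Suc m)" and "w = 39/20 * x + 263/200 * real m"
      have "0 < q"
        unfolding q_def using a by (intro add_pos_nonneg) auto
      have "z = w / real (Suc m) / (q / real (Suc (Suc m))) - 1"
        by (simp only: z_def A_def q_def w_def)
      hence "real (Suc m) * z = real (Suc m) * (w / real (Suc m) / (q / real (Suc (Suc m))) - 1)"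
        by (rule arg_cong)
      also have "\<dots> = (w * real (Suc (Suc m)) - q * real (Suc m)) / q"
        using \<open>0 < q\<close> by (simp add: field_simps del: of_nat_Suc)
      also have "w * real (Suc (Suc m)) - q * real (Suc m) = 39/20 * x - 263/200"
        by (simp add: w_def q_def field_simps)
      finally show ?thesis
        by (simp add: q_def)
    qed
    have "-1 \<le> z"
      using A_pos[of m] A_pos[of "Suc m"] by (simp add: z_def)
    hence bern: "1 + real (Suc m) * z \<le> (A m / A (Suc m)) ^ Suc m"
      using Bernoulli_inequality[of z "Suc m"] by (simp add: z_def)
    \<comment> \<open>With these bounds the x * m term of the difference below absorbs all negative
      terms; here 9 \<le> x and 6 \<le> m \<le> 150 enter.\<close>
    have "9 * (real m * real m) \<le> 150 * (x * real m)" "6 * x \<le> x * real m" "9 * real m \<le> x * real m"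
      using Suc a mult_mono[of "real m" 150 9 x] mult_right_mono[of "9 * real m" "150 * x" "real m"]
      by (auto simp: mult_ac intro!: mult_left_mono mult_right_mono)
    moreover have "0 \<le> x * x"
      by simp
    moreover have "(x + 129/100 * real m) * (39/10 * x + 263/200 * real m)
        - (39/20 * x + 263/200 * real m) * (39/20 * x + 263/200 * real (Suc m))
        = 39/400 * (x * x) + 487/400 * (x * real m) - 263/8000 * (real m * real m)
          - 10257/4000 * x - 69169/40000 * real m"
      by (simp add: field_simps)
    ultimately have "(39/20 * x + 263/200 * real m) * (39/20 * x + 263/200 * real (Suc m))
        \<le> (x + 129/100 * real m) * (39/10 * x + 263/200 * real m)"
      using a by linarith
    moreover have "1 + real (Suc m) * z = (39/10 * x + 263/200 * real m) / (39/20 * x + 263/200 * real (Suc m))"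
      unfolding z using a by (simp add: field_simps)
    moreover have "0 < 39/20 * x + 263/200 * real (Suc m)"
      using a by (intro add_pos_nonneg) auto
    ultimately have "39/20 * x + 263/200 * real m \<le> (x + 129/100 * real m) * (1 + real (Suc m) * z)"
      by (simp only: times_divide_eq_right pos_le_divide_eq)
    hence "A m * real (Suc m) \<le> (x + 129/100 * real m) * (1 + real (Suc m) * z)"
      by (simp add: A_def del: of_nat_Suc)
    also have "\<dots> \<le> (x + 129/100 * real m) * (A m / A (Suc m)) ^ Suc m"
      using bern a by (intro mult_left_mono) auto
    finally have "A m * real (Suc m) \<le> A m * ((x + 129/100 * real m) * A m ^ m / A (Suc m) ^ Suc m)"
      by (simp add: power_divide mult_ac del: of_nat_Suc)
    hence "real (Suc m) \<le> (x + 129/100 * real m) * A m ^ m / A (Suc m) ^ Suc m"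
      using A_pos[of m] by (simp only: mult_le_cancel_left_pos)
    hence "A (Suc m) ^ Suc m * real (Suc m) \<le> (x + 129/100 * real m) * A m ^ m"
      using zero_less_power[OF A_pos[of "Suc m"], of "Suc m"]
      by (simp only: pos_le_divide_eq mult.commute[of "real (Suc m)"])
    hence "A (Suc m) ^ Suc m \<le> (x + 129/100 * real m) / real (Suc m) * A m ^ m"
      by (simp only: pos_le_divide_eq of_nat_0_less_iff zero_less_Suc times_divide_eq_left)
    also have "\<dots> < (x + 129/100 * real m) / real (Suc m) * P m x"
      using Suc a by (intro mult_strict_left_mono) auto
    also have "\<dots> \<le> P (Suc m) x"
      using Suc by (intro low) auto
    finally show ?case .
  qed
  have "P (Suc n) x ^ n \<le> (A n * P n x) ^ n"
    using a n by (intro power_mono up P_nonneg) auto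
  also have "\<dots> = A n ^ n * P n x ^ n"
    by (simp add: power_mult_distrib)
  also have "\<dots> < P n x * P n x ^ n"
    using gt[of n] n A_pos[of n] by (intro mult_strict_right_mono zero_less_power) (auto intro: less_trans[OF zero_less_power])
  finally show ?thesis
    by simp
qed

section \<open>Tables of exact values\<close>

text \<open>Entry i is sigma (i + 1). The values are stored so that growing a table does not
  recompute divisor sums.\<close>

definition sigmas :: "int list" where
  "sigmas = [
    1, 3, 4, 7, 6, 12, 8, 15, 13, 18, 12, 28, 14, 24, 24, 31, 18, 39, 20, 42, 32, 36, 24,
    60, 31, 42, 40, 56, 30, 72, 32, 63, 48, 54, 48, 91, 38, 60, 56, 90, 42, 96, 44, 84,
    78, 72, 48, 124, 57, 93, 72, 98, 54, 120, 72, 120, 80, 90, 60, 168, 62, 96, 104, 127,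
    84, 144, 68, 126, 96, 144, 72, 195, 74, 114, 124, 140, 96, 168, 80, 186, 121, 126, 84,
    224, 108, 132, 120, 180, 90, 234, 112, 168, 128, 144, 120, 252, 98, 171, 156, 217,
    102, 216, 104, 210, 192, 162, 108, 280, 110, 216, 152, 248, 114, 240, 144, 210, 182,
    180, 144, 360, 133, 186, 168, 224, 156, 312, 128, 255, 176, 252, 132, 336, 160, 204,
    240, 270, 138, 288, 140, 336, 192, 216, 168, 403, 180, 222, 228, 266, 150, 372, 152]"

definition divisor_sum :: "int \<Rightarrow> int" where
  "divisor_sum m = sum_list (filter (\<lambda>d. m mod d = 0) [1..m])"

lemma divisor_sum: "0 < m \<Longrightarrow> divisor_sum (int m) = int (sigma m)"
proof -
  assume m: "0 < m"
  have "int (sigma m) = (\<Sum>d\<in>int ` {d. d dvd m}. d)"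
    by (subst sum.reindex) (auto simp: sigma_def)
  also have "int ` {d. d dvd m} = {d \<in> {1..int m}. int m mod d = 0}"
  proof (intro set_eqI iffI)
    fix d assume "d \<in> {d \<in> {1..int m}. int m mod d = 0}"
    hence "d = int (nat d)" "nat d dvd m"
      by (auto simp: mod_eq_0_iff_dvd nat_dvd_iff)
    thus "d \<in> int ` {d. d dvd m}"
      by blast
  qed (use m in \<open>auto simp: mod_eq_0_iff_dvd dest: dvd_imp_le dvd_pos_nat\<close>)
  also have "\<Sum> \<dots> = divisor_sum (int m)"
    by (simp add: divisor_sum_def distinct_sum_list_conv_Sum)
  finally show ?thesis
    by simp
qed

lemma sigmas_code: "map divisor_sum [1..151] = sigmas"
  by code_simp

lemma length_sigmas: "length sigmas = 151"
  by (simp add: sigmas_def)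

lemma sigmas_nth: "i < 151 \<Longrightarrow> sigmas ! i = int (sigma (Suc i))"
proof -
  assume i: "i < 151"
  hence "sigmas ! i = divisor_sum ([1..151] ! i)"
    by (simp flip: sigmas_code)
  also have "[1..151] ! i = int (Suc i)"
    using i by simp
  finally show ?thesis
    by (simp add: divisor_sum del: of_nat_Suc)
qed

text \<open>Stopping with the shorter list allows all of \<open>sigmas\<close> to be paired with a
  partial table; on a reversed table this is the convolution in \<open>P_Suc\<close>.\<close>

fun dot :: "int list \<Rightarrow> int list \<Rightarrow> int" where
  "dot (x # xs) (y # ys) = x * y + dot xs ys"
| "dot _ _ = 0"

lemma dot_conv_sum: "length ys \<le> length xs \<Longrightarrow> dot xs ys = (\<Sum>i<length ys. xs ! i * ys ! i)"
  by (induction xs ys rule: dot.induct) (simp_all add: sum.lessThan_Suc_shift del: sum.lessThan_Suc)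

text \<open>
  The table is built in reverse order. An inexact division empties the list, and it then stays empty, so that
  \<open>below_line\<close> fails. The intermediate values are passed as arguments because a \<open>let\<close> would be
  unfolded by the simplifier before its value is computed.
\<close>

definition push_if_exact :: "int \<Rightarrow> int \<Rightarrow> int \<Rightarrow> int list \<Rightarrow> int list" where
  "push_if_exact c s t ts = (if c * t = s then t # ts else [])"

definition push_quotient :: "int \<Rightarrow> int \<Rightarrow> int list \<Rightarrow> int list" where
  "push_quotient c s ts = push_if_exact c s (s div c) ts"

fun grow :: "int \<Rightarrow> int \<Rightarrow> nat \<Rightarrow> int \<Rightarrow> int list \<Rightarrow> int list" where
  "grow p q 0 k ts = ts"
| "grow p q (Suc f) k [] = []"
| "grow p q (Suc f) k (t # ts) =
     grow p q f (k + 1) (push_quotient (q * k) (p * dot sigmas (t # ts)) (t # ts))"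

text \<open>The scale M clears denominators at a rational point. The empty list is vacuously a
  table, so lengths are tested separately by \<open>below_line\<close>.\<close>

definition is_table :: "real \<Rightarrow> real \<Rightarrow> int list \<Rightarrow> bool" where
  "is_table M a ts \<longleftrightarrow> (\<forall>i<length ts. of_int (ts ! i) = M * P i a)"

lemma is_table_snoc:
  assumes ts: "is_table M (of_int p / of_int q) (rev ts)" and "0 < q" "0 < length ts" "length ts \<le> 151"
    and t: "q * int (length ts) * t = p * dot sigmas ts"
  shows "is_table M (of_int p / of_int q) (rev (t # ts))"
proof -
  define a :: real where "a = of_int p / of_int q"
  obtain n where n: "length ts = Suc n"
    using assms by (cases "length ts") auto
  have nth: "of_int (ts ! k) = M * P (n - k) a" if "k \<le> n" for k
  proof -
    have "ts ! k = rev ts ! (n - k)"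
      using that n by (simp add: rev_nth)
    thus ?thesis
      using ts that n by (simp add: is_table_def a_def)
  qed
  have "real_of_int (dot sigmas ts) = (\<Sum>k\<le>n. real (sigma (Suc k)) * (M * P (n - k) a))"
    using assms n by (simp add: dot_conv_sum length_sigmas lessThan_Suc_atMost sigmas_nth nth cong: sum.cong_simp)
  hence "a * real_of_int (dot sigmas ts) = M * (real (Suc n) * P (Suc n) a)"
    unfolding P_Suc by (simp add: sum_distrib_left mult_ac)
  moreover have "real_of_int q * real (Suc n) * real_of_int t = real_of_int p * real_of_int (dot sigmas ts)"
    using arg_cong[OF t, of real_of_int] n by simp
  hence "a * real_of_int (dot sigmas ts) = real (Suc n) * real_of_int t"
    using \<open>0 < q\<close> by (simp add: a_def field_simps)
  ultimately have "real_of_int t = M * P (Suc n) a"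
    by (simp del: of_nat_Suc)
  thus ?thesis
    using ts n unfolding a_def by (auto simp: is_table_def nth_append less_Suc_eq)
qed

text \<open>An exact division is one step of the recursion. The limit of 152 entries reaches
  \<open>P 151\<close>, whose computation uses all of \<open>sigmas\<close>.\<close>

lemma is_table_grow:
  assumes "is_table M (of_int p / of_int q) (rev ts)" "0 < q" "k = int (length ts)" "f + length ts \<le> 152"
  shows "is_table M (of_int p / of_int q) (rev (grow p q f k ts))"
  using assms
proof (induction p q f k ts rule: grow.induct)
  case (3 p q f k t ts)
  define s where "s = p * dot sigmas (t # ts)"
  have eq: "grow p q (Suc f) k (t # ts) = grow p q f (k + 1) (push_if_exact (q * k) s (s div (q * k)) (t # ts))"
    by (simp add: s_def push_quotient_def)
  show ?case
  proof (cases "q * k * (s div (q * k)) = s")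
    case True
    have "is_table M (of_int p / of_int q) (rev ((s div (q * k)) # t # ts))"
      using 3(2-5) True by (intro is_table_snoc[of _ _ _ "t # ts"]) (simp_all add: s_def)
    thus ?thesis
      using 3 True unfolding eq by (simp add: s_def push_quotient_def push_if_exact_def)
  next
    case False
    have "grow p q f (k + 1) [] = []"
      by (cases f) auto
    thus ?thesis
      using False unfolding eq by (simp add: is_table_def push_if_exact_def)
  qed
qed auto

definition table :: "int \<Rightarrow> int \<Rightarrow> int \<Rightarrow> nat \<Rightarrow> int list" where
  "table p q M f = rev (grow p q f 1 [M])"

lemma is_table_table:
  "0 < q \<Longrightarrow> f \<le> 151 \<Longrightarrow> is_table (of_int M) (of_int p / of_int q) (table p q M f)"
  unfolding table_def by (intro is_table_grow) (auto simp: is_table_def)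

section \<open>Linear bounds read off a table\<close>

text \<open>The integer e clears the denominators of the line; negating e, \<alpha> and \<beta>
  turns the test into one for a lower line.\<close>

fun below_line :: "int \<Rightarrow> int \<Rightarrow> int \<Rightarrow> nat \<Rightarrow> int \<Rightarrow> int list \<Rightarrow> bool" where
  "below_line e \<alpha> \<beta> 0 i ts = True"
| "below_line e \<alpha> \<beta> (Suc f) i (s # t # ts) =
     (e * (i + 1) * t \<le> (\<alpha> + \<beta> * i) * s \<and> below_line e \<alpha> \<beta> f (i + 1) (t # ts))"
| "below_line e \<alpha> \<beta> (Suc f) i ts = False"

lemma below_lineD:
  assumes "below_line e \<alpha> \<beta> f k ts" "i < f"
  shows "Suc i < length ts \<and> e * (k + int i + 1) * ts ! Suc i \<le> (\<alpha> + \<beta> * (k + int i)) * ts ! i"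
  using assms
proof (induction e \<alpha> \<beta> f k ts arbitrary: i rule: below_line.induct)
  case (2 e \<alpha> \<beta> f k s t ts)
  show ?case
  proof (cases i)
    case (Suc j)
    thus ?thesis
      using 2(1)[of j] 2(2,3) by (simp add: ac_simps)
  qed (use 2 in simp)
qed auto

lemma below_line_table:
  assumes "is_table M a ts" "0 < M" "below_line e \<alpha> \<beta> f 0 ts" "i < f"
  shows "of_int e * (real (Suc i) * P (Suc i) a) \<le> (of_int \<alpha> + of_int \<beta> * real i) * P i a"
proof -
  have *: "Suc i < length ts" "e * int (Suc i) * ts ! Suc i \<le> (\<alpha> + \<beta> * int i) * ts ! i"
    using below_lineD[OF assms(3,4)] by (auto simp: ac_simps)
  have "M * (of_int e * (real (Suc i) * P (Suc i) a)) = of_int (e * int (Suc i) * ts ! Suc i)"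
    using assms(1) * by (simp add: is_table_def)
  also have "\<dots> \<le> of_int ((\<alpha> + \<beta> * int i) * ts ! i)"
    using * by (simp only: of_int_le_iff)
  also have "\<dots> = M * ((of_int \<alpha> + of_int \<beta> * real i) * P i a)"
    using assms(1) * by (simp add: is_table_def)
  finally show ?thesis
    using \<open>0 < M\<close> by simp
qed

section \<open>Checking a block of indices on an interval\<close>

definition good :: "nat \<Rightarrow> real \<Rightarrow> bool" where
  "good n x \<longleftrightarrow> P (Suc n) x ^ n < P n x ^ Suc n"

text \<open>
  Base point \<open>a = p/q\<close>, interval \<open>[a, d/d']\<close>, indices \<open>N..L\<close>, line \<open>(\<alpha> + \<beta> i)/e\<close>, bound \<open>\<rho> = u/w\<close>;
  the list \<open>ts\<close> holds the integers \<open>M * P i a\<close>.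
\<close>

definition block_ok :: "int \<Rightarrow> int \<Rightarrow> int \<Rightarrow> int \<Rightarrow> int \<Rightarrow> int list \<Rightarrow> nat \<Rightarrow>
    nat \<Rightarrow> int \<Rightarrow> int \<Rightarrow> int \<Rightarrow> int \<Rightarrow> int \<Rightarrow> bool" where
  "block_ok p q M d d' ts N L e \<alpha> \<beta> u w \<longleftrightarrow>
     0 < e \<and> 0 < u \<and> 0 < w \<and> 0 \<le> \<alpha> \<and> w * \<beta> \<le> u * e
     \<and> w * (\<alpha> * q * d + \<beta> * int N * p * d') \<le> u * (int N + 1) * e * p * d'
     \<and> M * u ^ L < ts ! L * w ^ L \<and> below_line e \<alpha> \<beta> (Suc L) 0 ts"

text \<open>The integer tests are the hypotheses of \<open>P_power_less_block\<close> with
  denominators cleared.\<close>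

lemma block_ok_good:
  assumes ok: "block_ok p q M d d' ts N L e \<alpha> \<beta> u w"
    and ts: "is_table (of_int M) (of_int p / of_int q) ts" and pos: "0 < p" "0 < q" "0 < M" "0 < d'"
    and x: "of_int p / of_int q \<le> x" "x \<le> of_int d / of_int d'" and n: "N \<le> n" "n \<le> L"
  shows "good n x"
  unfolding good_def
proof (rule P_power_less_block[where a = "of_int p / of_int q" and d = "of_int d / of_int d'" and N = N and M = L
      and \<alpha> = "of_int \<alpha> / of_int e" and \<beta> = "of_int \<beta> / of_int e" and \<rho> = "of_int u / of_int w"])
  have e: "0 < e" and uw: "0 < u" "0 < w" and \<alpha>: "0 \<le> \<alpha>" and \<beta>: "w * \<beta> \<le> u * e"
    and step: "w * (\<alpha> * q * d + \<beta> * int N * p * d') \<le> u * (int N + 1) * e * p * d'"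
    and pow: "M * u ^ L < ts ! L * w ^ L" and line: "below_line e \<alpha> \<beta> (Suc L) 0 ts"
    using ok by (auto simp: block_ok_def)
  show "real (Suc i) * P (Suc i) (of_int p / of_int q)
      \<le> (of_int \<alpha> / of_int e + of_int \<beta> / of_int e * real i) * P i (of_int p / of_int q)" if "i \<le> L" for i
  proof -
    have "of_int e * (real (Suc i) * P (Suc i) (of_int p / of_int q))
        \<le> (of_int \<alpha> + of_int \<beta> * real i) * P i (of_int p / of_int q)"
      using that pos by (intro below_line_table[OF ts _ line]) auto
    thus ?thesis
      using e by (simp add: field_simps del: of_nat_Suc)
  qed
  show "of_int \<beta> / of_int e \<le> real_of_int u / of_int w"
    using e uw of_int_le_iff[where 'a = real, THEN iffD2, OF \<beta>] by (simp add: field_simps)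
  show "of_int \<alpha> / of_int e * (of_int d / of_int d' / (of_int p / of_int q)) + of_int \<beta> / of_int e * real N
      \<le> of_int u / of_int w * real (Suc N)"
    using e uw pos of_int_le_iff[where 'a = real, THEN iffD2, OF step] by (simp add: field_simps)
  have "Suc L < length ts"
    using below_lineD[OF line, of L] by simp
  hence "real_of_int (ts ! L) = of_int M * P L (of_int p / of_int q)"
    using ts by (simp add: is_table_def)
  thus "(of_int u / of_int w) ^ L < P L (of_int p / of_int q)"
    using pos uw of_int_less_iff[where 'a = real, THEN iffD2, OF pow] by (simp add: power_divide field_simps)
qed (use ok pos x n in \<open>auto simp: block_ok_def\<close>)

fun blocks_ok :: "int \<Rightarrow> int \<Rightarrow> int \<Rightarrow> int \<Rightarrow> int \<Rightarrow> int list \<Rightarrow> nat \<Rightarrow> nat \<Rightarrow>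
    (nat \<times> int \<times> int \<times> int \<times> int \<times> int) list \<Rightarrow> bool" where
  "blocks_ok p q M d d' ts N N' [] = (N' < N)"
| "blocks_ok p q M d d' ts N N' ((L, e, \<alpha>, \<beta>, u, w) # bs) =
     (block_ok p q M d d' ts N L e \<alpha> \<beta> u w \<and> blocks_ok p q M d d' ts (Suc L) N' bs)"

lemma blocks_ok_good:
  assumes "blocks_ok p q M d d' ts N N' bs"
    and "is_table (of_int M) (of_int p / of_int q) ts" "0 < p" "0 < q" "0 < M" "0 < d'"
    and "of_int p / of_int q \<le> x" "x \<le> of_int d / of_int d'" "N \<le> n" "n \<le> N'"
  shows "good n x"
  using assms
proof (induction p q M d d' ts N N' bs rule: blocks_ok.induct)
  case (2 p q M d d' ts N N' L e \<alpha> \<beta> u w bs)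
  show ?case
  proof (cases "n \<le> L")
    case True
    thus ?thesis
      using 2 by (auto intro: block_ok_good)
  qed (use 2 in simp)
qed simp

text \<open>The exponent k has to make all divisions exact. \<open>Suc N'\<close> growth steps reach
  P (N' + 1), the numerator of the last ratio.\<close>

definition stage_ok :: "int \<Rightarrow> int \<Rightarrow> nat \<Rightarrow> int \<Rightarrow> int \<Rightarrow> nat \<Rightarrow> nat \<Rightarrow>
    (nat \<times> int \<times> int \<times> int \<times> int \<times> int) list \<Rightarrow> bool" where
  "stage_ok p q k d d' N N' bs \<longleftrightarrow> 0 < p \<and> 0 < q \<and> 0 < d' \<and> N' < 151
     \<and> blocks_ok p q (q ^ k) d d' (table p q (q ^ k) (Suc N')) N N' bs"

lemma stage_ok_good:
  assumes "stage_ok p q k d d' N N' bs"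
    and "of_int p / of_int q \<le> x" "x \<le> of_int d / of_int d'" "N \<le> n" "n \<le> N'"
  shows "good n x"
  using assms is_table_table[of q "Suc N'" "q ^ k" p]
  by (auto simp: stage_ok_def intro!: blocks_ok_good[of p q "q ^ k" d d' _ N N' bs])

section \<open>Certificates\<close>

lemma good_from_9:
  assumes "9 \<le> x" "6 \<le> n" "n \<le> 150"
  shows "good n x"
proof -
  let ?T = "table 9 1 1 151"
  have T: "is_table (of_int 1) (of_int 9 / of_int 1) ?T"
    by (intro is_table_table) auto
  \<comment> \<open>The upper line at 9 is scaled by 200, the lower one by -100, which reverses its
    inequality.\<close>
  have *: "below_line 200 3510 263 151 0 ?T \<and> below_line (-100) (-900) (-129) 151 0 ?T"
    by code_simp
  have "200 * (real (Suc i) * P (Suc i) 9) \<le> (3510 + 263 * real i) * P i 9" if "i \<le> 150" for i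
    using below_line_table[OF T _ *[THEN conjunct1], of i] that by (simp del: of_nat_Suc)
  moreover have "-100 * (real (Suc i) * P (Suc i) 9) \<le> (-900 - 129 * real i) * P i 9" if "i \<le> 150" for i
    using below_line_table[OF T _ *[THEN conjunct2], of i] that by (simp del: of_nat_Suc)
  ultimately show ?thesis
    unfolding good_def using assms
    by (intro P_power_less_tail[of 9]) (simp_all add: field_simps del: of_nat_Suc)
qed

text \<open>
  The certificates come from a numerical search: for each block the line is chosen to minimise the resulting
  bound \<open>\<rho>\<close>. Short intervals are needed only near \<open>x = 1\<close> for small \<open>n\<close>, where \<open>P\<^sub>n\<^bsup>1/n\<^esup>\<close>
  barely exceeds \<open>P\<^sub>n\<^sub>+\<^sub>1 / P\<^sub>n\<close>; the tightest case is \<open>n = 7\<close>.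
\<close>

lemma stage1: "stage_ok 1 1 0 2 1 50 150
    [(53, 256, 1134, 286, 325, 256), (59, 512, 2268, 572, 645, 512), (69, 512, 2385, 568, 637, 512),
      (84, 1024, 4770, 1136, 1255, 1024), (107, 1024, 5253, 1123, 1233, 1024), (144, 128, 723, 139,
      151, 128), (150, 64, 392, 69, 74, 64)]"
  by code_simp

lemma stage2: "stage_ok 1 1 0 3 2 25 49
    [(32, 1024, 4072, 1166, 1357, 1024), (48, 32, 136, 36, 41, 32), (49, 8, 34, 9, 10, 8)]"
  by code_simp

lemma stage3: "stage_ok 1 1 0 5 4 12 24
    [(12, 128, 452, 151, 183, 128), (15, 512, 1815, 603, 722, 512), (22, 128, 506, 146, 175, 128),
      (24, 16, 68, 18, 21, 16)]"
  by code_simp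

lemma stage4: "stage_ok 1 1 0 11 10 8 11
    [(8, 32, 257, 17, 47, 32), (10, 64, 240, 73, 93, 64), (11, 16, 56, 19, 23, 16)]"
  by code_simp

lemma stage5: "stage_ok 1 1 0 11 10 6 6
    [(6, 512, 4528, 60, 763, 512)]"
  by code_simp

lemma stage6: "stage_ok 1 1 0 101 100 7 7
    [(7, 1024, 3755, 1180, 1507, 1024)]"
  by code_simp

lemma stage7: "stage_ok 101 100 12 41 40 7 7
    [(7, 128, 469, 148, 189, 128)]"
  by code_simp

lemma stage8: "stage_ok 41 40 11 21 20 7 7
    [(7, 64, 236, 74, 95, 64)]"
  by code_simp

lemma stage9: "stage_ok 21 20 12 11 10 7 7
    [(7, 1024, 3770, 1190, 1535, 1024)]"
  by code_simp

lemma stage10: "stage_ok 11 10 22 7 6 6 11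
    [(6, 8, 67, 2, 12, 8), (8, 256, 947, 300, 389, 256), (11, 32, 117, 38, 47, 32)]"
  by code_simp

lemma stage11: "stage_ok 7 6 22 5 4 6 11
    [(6, 16, 125, 6, 25, 16), (9, 512, 1909, 606, 786, 512), (11, 8, 28, 10, 12, 8)]"
  by code_simp

lemma stage12: "stage_ok 5 4 36 7 5 6 24
    [(6, 8, 59, 4, 13, 8), (8, 64, 240, 77, 101, 64), (14, 128, 474, 155, 193, 128), (24, 32, 141,
      37, 45, 32)]"
  by code_simp

lemma stage13: "stage_ok 7 5 31 3 2 6 24
    [(9, 64, 249, 78, 105, 64), (21, 512, 1958, 629, 763, 512), (24, 8, 45, 9, 11, 8)]"
  by code_simp

lemma stage14: "stage_ok 3 2 97 2 1 8 49
    [(9, 512, 2001, 635, 861, 512), (13, 64, 254, 79, 103, 64), (22, 128, 499, 159, 193, 128), (43,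
      64, 308, 75, 89, 64), (49, 16, 98, 18, 21, 16)]"
  by code_simp

lemma stage15: "stage_ok 3 2 15 9 5 6 7
    [(6, 8, 41, 8, 14, 8), (7, 16, 62, 20, 27, 16)]"
  by code_simp

lemma stage16: "stage_ok 9 5 9 2 1 6 7
    [(7, 16, 64, 21, 29, 16)]"
  by code_simp

lemma stage17: "stage_ok 2 1 0 14 5 6 6
    [(6, 8, 32, 11, 16, 8)]"
  by code_simp

lemma stage18: "stage_ok 14 5 8 3 1 6 6
    [(6, 8, 47, 10, 16, 8)]"
  by code_simp

lemma stage19: "stage_ok 2 1 0 3 1 7 150
    [(7, 64, 239, 91, 125, 64), (9, 128, 547, 168, 241, 128), (13, 256, 1094, 336, 455, 256), (20,
      32, 145, 41, 53, 32), (35, 512, 2577, 632, 779, 512), (66, 1024, 6130, 1211, 1427, 1024),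
      (133, 256, 1914, 291, 329, 256), (150, 8, 65, 9, 10, 8)]"
  by code_simp

lemma stage20: "stage_ok 3 1 0 5 1 6 150
    [(6, 16, 77, 24, 39, 16), (8, 256, 1219, 385, 591, 256), (11, 128, 667, 181, 275, 128), (16,
      128, 702, 176, 253, 128), (25, 128, 737, 172, 231, 128), (41, 64, 433, 81, 105, 64), (72, 512,
      3983, 623, 763, 512), (133, 1024, 9675, 1195, 1397, 1024), (150, 16, 191, 18, 21, 16)]"
  by code_simp

lemma stage21: "stage_ok 5 1 0 9 1 6 150
    [(6, 8, 55, 13, 26, 8), (8, 8, 55, 13, 24, 8), (11, 32, 216, 53, 87, 32), (16, 16, 115, 25, 39,
      16), (24, 64, 521, 92, 139, 64), (38, 2048, 18076, 2824, 3967, 2048), (62, 256, 2585, 334,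
      442, 256), (106, 128, 1510, 159, 199, 128), (150, 16, 228, 19, 23, 16)]"
  by code_simp

lemma good_from_1:
  assumes "1 \<le> x" "6 \<le> n" "n \<le> 150"
  shows "good n x"
proof -
  note stages = stage1 stage2 stage3 stage4 stage5 stage6 stage7 stage8 stage9 stage10 stage11
    stage12 stage13 stage14 stage15 stage16 stage17 stage18 stage19 stage20 stage21
  note st = stages[THEN stage_ok_good, of x n, simplified]
  \<comment> \<open>For each of these ranges of n the stage intervals form a chain from 1 to
    9.\<close>
  consider "n = 6" | "n = 7" | "8 \<le> n" "n \<le> 11" | "12 \<le> n" "n \<le> 24" | "25 \<le> n" "n \<le> 49" | "50 \<le> n"
    using assms by linarith
  thus ?thesis
  proof cases
    case 1
    thus ?thesis
      using assms st(5,10-13,15-18,20,21) good_from_9[of x n] by simp (metis linear)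
  next
    case 2
    thus ?thesis
      using assms st(6-13,15,16,19-21) good_from_9[of x n] by simp (metis linear)
  next
    case 3
    thus ?thesis
      using assms st(4,10-14,19-21) good_from_9[of x n] by simp (metis linear)
  next
    case 4
    thus ?thesis
      using assms st(3,12-14,19-21) good_from_9[of x n] by simp (metis linear)
  next
    case 5
    thus ?thesis
      using assms st(2,14,19-21) good_from_9[of x n] by simp (metis linear)
  next
    case 6
    thus ?thesis
      using assms st(1,19-21) good_from_9[of x n] by simp (metis linear)
  qed
qed

theorem theorem3p2:
  fixes n :: nat
  assumes "6 \<le> n" and "n \<le> 150"
  shows "largest_zero n < 1"
proof -
  have poly_Delta: "poly (Delta n) x = P n x ^ Suc n - P (Suc n) x ^ n" for x
    by (simp add: Delta_def P_def del: darcais.simps)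
  have pos: "0 < poly (Delta n) x" if "1 \<le> x" for x
    using good_from_1[OF that assms] by (simp add: poly_Delta good_def)
  let ?Z = "{x. poly (Delta n) x = 0}"
  \<comment> \<open>Positivity at 1 makes the zero set finite, and 0 makes it nonempty, so
    \<open>Max\<close> is a genuine zero.\<close>
  have "Delta n \<noteq> 0"
    using pos[of 1] by auto
  hence "finite ?Z"
    by (rule poly_roots_finite)
  moreover have "0 \<in> ?Z"
    using assms by (simp add: poly_Delta P_at_0)
  ultimately have "Max ?Z \<in> ?Z"
    by (intro Max_in) auto
  thus ?thesis
    using pos[of "Max ?Z"] by (force simp: largest_zero_def)
qed

end
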